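(* Let $R$ be a nonzero commutative ring of characteristic $\mathfrak{N}$, and let $T: R[x]\to R[x]$ be the Collatz map defined below. \begin{enumerate} \item If $\mathfrak{N}=0$, then the only $T$-cycles in $R[x]$ are $(0)$ and those of the form $(a,ax)$, for all $0\neq a\in R$. \item Assume $\mathfrak{N}=\prod_{i=1}^s p_i^{\alpha_i}>0$, where $s\ge 1$, $p_1,\dots,p_s$ are distinct primes and $\alpha_1,\dots,\alpha_s\ge 1$. Then: \begin{itemize} \item every $f\in R[x]$ is eventually periodic with respect to $T$; \item if $f=\sum_{k=0}^n b_kx^k\in R[x]$ is a $T$-periodic polynomial with $b_0\neq 0$ and $b_n\neq 0$, and $\rho_T(f)$ denotes the length of its $T$-cycle, then $$\rho_T(f)\ \Big|\ 2\prod_{i=1}^s p_i^{\alpha_i+\lfloor \log_{p_i}(\deg f)\rfloor};$$ moreover, if $b_n\in R^\times$, then $\rho_T(f)=2\prod_{i=1}^s p_i^{\alpha_i+\lfloor \log_{p_i}(\deg f)\rfloor}$. \end{itemize} \end{enumerate}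
   Context: For $f\in R[x]$ let $f_0$ denote its constant coefficient. The Collatz map $T:R[x]\to R[x]$ is $T(f)=f\cdot(x+1)-f_0$ if $f_0\neq 0$, and $T(f)=f/x$ if $f_0=0$. A polynomial $f$ is $T$-periodic if $T^k(f)=f$ for some $k\ge1$; the minimal such $k$ is $\rho_T(f)$, and the sequence $(f,T(f),\dots,T^{k-1}(f))$ (the orbit of $f$) is a $T$-cycle, of length $\rho_T(f)$. A polynomial $f$ is eventually periodic if $T^m(f)$ is $T$-periodic for some $m\ge 0$. $R^\times$ is the group of units of $R$; $\lfloor\cdot\rfloor$ is the floor function.
   Formalization: In part 1, that there are no other T-cycles is stated for R additively torsion-free (otherwise false: 1+tx with mt=0, m>0, t≠0 is periodic); in part 2 the equality for ρ_T(f) is stated for deg f ≥ 1, since log_p(0) is undefined. *)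

theory Defs
  imports Complex_Main "HOL-Computational_Algebra.Polynomial" "HOL-Computational_Algebra.Primes"
begin

(* poly_shift 1 f drops the constant coefficient and shifts the others down,
   so it is f/x when the constant coefficient vanishes. *)
definition collatz :: "'a::comm_ring_1 poly \<Rightarrow> 'a poly" where
  "collatz f = (if coeff f 0 \<noteq> 0 then f * [:1, 1:] - [:coeff f 0:] else poly_shift 1 f)"

definition collatz_periodic :: "'a::comm_ring_1 poly \<Rightarrow> bool" where
  "collatz_periodic f \<longleftrightarrow> (\<exists>k\<ge>1. (collatz ^^ k) f = f)"

(* Meaningful only for periodic f. *)
definition collatz_period :: "'a::comm_ring_1 poly \<Rightarrow> nat" where
  "collatz_period f = (LEAST k. k \<ge> 1 \<and> (collatz ^^ k) f = f)"

definition collatz_orbit :: "'a::comm_ring_1 poly \<Rightarrow> 'a poly list" where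
  "collatz_orbit f = map (\<lambda>i. (collatz ^^ i) f) [0..<collatz_period f]"

(* A cycle is recorded as a sequence with a starting point: all the rotations of a
   cycle satisfy this predicate. *)
definition collatz_cycle :: "'a::comm_ring_1 poly list \<Rightarrow> bool" where
  "collatz_cycle c \<longleftrightarrow> (\<exists>f. collatz_periodic f \<and> c = collatz_orbit f)"

definition collatz_eventually_periodic :: "'a::comm_ring_1 poly \<Rightarrow> bool" where
  "collatz_eventually_periodic f \<longleftrightarrow> (\<exists>m. collatz_periodic ((collatz ^^ m) f))"

(* For a nonzero ring this implies CHAR('a) = 0. The converse fails, e.g. for Z \<times> Z/2,
   and characteristic 0 alone does not exclude further cycles: if CHAR('a) = 0, m > 0, t \<noteq> 0
   and m t = 0, then 1 + t x is periodic, since two steps send b + t x with b \<noteq> 0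
   to (b + t) + t x. *)
definition additively_torsion_free :: "'a::comm_ring_1 itself \<Rightarrow> bool" where
  "additively_torsion_free _ \<longleftrightarrow> (\<forall>m>0. \<forall>a::'a. of_nat m * a = 0 \<longrightarrow> a = 0)"

end

(* Write S for the map that drops the constant coefficient and shifts the others down.
   If the constant coefficient of f is nonzero then T^2 f = (1 + S) f, and T f = S f otherwise.
   Two consecutive vanishing constant coefficients strictly lower the degree (suitably measured),
   so they cannot occur on a nonzero cycle. A cycle through f with nonzero constant coefficient thus has
   length twice the least j > 0 with (1 + S)^j f = f. Since S is nilpotent on polynomials of
   degree n, this order is governed by the vanishing in R of the binomial coefficients
   (j choose i) with 1 <= i <= n, i.e. by their p-adic valuations. *)
theory Submission
  imports Defs
begin

section \<open>Binomial coefficients modulo prime powers\<close>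

text \<open>In \<open>i * (M choose i) = M * (M - 1 choose (i - 1))\<close> the right side is
  divisible by \<open>p ^ (a + l)\<close>, while \<open>i < p ^ Suc l\<close> can absorb at most
  \<open>p ^ l\<close> of it.\<close>

lemma prime_power_dvd_choose:
  fixes p :: nat
  assumes "prime p" "p ^ (a + l) dvd M" "1 \<le> i" "i < p ^ Suc l"
  shows "p ^ a dvd (M choose i)"
proof -
  obtain r where r: "i = p ^ multiplicity p i * r" "\<not> p dvd r"
  proof (rule multiplicity_decompose')
    show "i \<noteq> 0" "\<not> is_unit p" using assms(1,3) not_prime_unit by auto
  qed
  define k where "k = multiplicity p i"
  have i: "i * c = r * c * p ^ k" for c
    using r(1) by (fold k_def) (metis mult.assoc mult.commute)
  have "p ^ k \<le> i"
    using assms(3) by (intro dvd_imp_le) (auto simp: k_def multiplicity_dvd)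
  hence "p ^ k < p ^ Suc l" using assms(4) by linarith
  hence "k \<le> l" using assms(1) prime_gt_1_nat[of p] by (simp del: power_Suc)
  have "p ^ a * p ^ k dvd p ^ (a + l)"
    using \<open>k \<le> l\<close> by (simp add: power_add le_imp_power_dvd)
  also have "\<dots> dvd i * (M choose i)"
    using assms(2,3) by (subst times_binomial_minus1_eq) auto
  also have "\<dots> = (r * (M choose i)) * p ^ k"
    by (rule i)
  finally have "p ^ a dvd r * (M choose i)"
    using assms(1) by (simp add: prime_gt_0_nat)
  \<comment> \<open>Cancelling the factor \<open>r\<close>, which is prime to \<open>p\<close>,
    works for positive exponents; \<open>a = 0\<close> is trivial.\<close>
  thus ?thesis
    using prime_power_dvd_multD[OF prime_imp_prime_elem[OF assms(1)] _ _ r(2)]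
    by (cases "a = 0") (simp, blast)
qed

text \<open>Modulo \<open>p\<close>, Pascal's rule and the vanishing of \<open>j choose i\<close>
  for \<open>0 < i < p ^ m\<close> make \<open>j - 1 choose i\<close> congruent to
  \<open>(-1) ^ i\<close>.\<close>

lemma not_prime_dvd_pred_choose:
  fixes p :: nat
  assumes "prime p" "p ^ m dvd j" "0 < j" "i < p ^ m"
  shows "\<not> p dvd (j - 1 choose i)"
  using assms(4)
proof (induction i)
  case 0
  then show ?case using prime_gt_1_nat[OF assms(1)] by simp
next
  case (Suc i)
  obtain j' where j: "j = Suc j'" using assms(3) by (cases j) auto
  obtain m' where m: "m = Suc m'" using Suc.prems by (cases m) auto
  have "p ^ 1 dvd (j choose Suc i)"
    using assms(1,2) Suc.prems by (intro prime_power_dvd_choose[where l = m']) (auto simp: m)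
  hence "p dvd (j' choose i) + (j' choose Suc i)" by (simp add: j)
  moreover have "\<not> p dvd (j' choose i)" using Suc j by simp
  ultimately show ?case by (auto simp: j dvd_add_left_iff)
qed

text \<open>A converse that tests only prime power indices. In \<open>p ^ Suc l * (j choose (p ^ Suc
  l)) = (j - 1 choose (p ^ Suc l - 1)) * j\<close> the binomial on the right is prime to
  \<open>p\<close>, so \<open>j\<close> carries the whole power of \<open>p\<close> found on the
  left.\<close>

lemma prime_power_dvd_of_dvd_choose:
  fixes p :: nat
  assumes "prime p" "1 \<le> a" "0 < j" "\<And>m. m \<le> l \<Longrightarrow> p ^ a dvd (j choose (p ^ m))"
  shows "p ^ (a + l) dvd j"
  using assms(4)
proof (induction l)
  case 0
  then show ?case using "0"[of 0] by simp
next
  case (Suc l)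
  have "p ^ (a + l) dvd j" using Suc by simp
  \<comment> \<open>Since \<open>a \<ge> 1\<close>, the induction hypothesis already yields the
    exponent \<open>Suc l\<close> that makes the cofactor prime to \<open>p\<close>.\<close>
  moreover have "p ^ Suc l dvd p ^ (a + l)" using assms(2) by (intro le_imp_power_dvd) simp
  ultimately have d: "p ^ Suc l dvd j" by (rule dvd_trans[rotated])
  have pos: "0 < p ^ Suc l" using assms(1) by (simp add: prime_gt_0_nat)
  have "p ^ (a + Suc l) dvd p ^ Suc l * (j choose (p ^ Suc l))"
    using Suc.prems[of "Suc l"] by (subst add.commute, subst power_add, intro mult_dvd_mono) auto
  also have "\<dots> = (j - 1 choose (p ^ Suc l - 1)) * j"
    using times_binomial_minus1_eq[OF pos, of j] by simp
  finally have "p ^ (a + Suc l) dvd (j - 1 choose (p ^ Suc l - 1)) * j" .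
  moreover have "\<not> p dvd (j - 1 choose (p ^ Suc l - 1))"
    using not_prime_dvd_pred_choose[OF assms(1) d assms(3)] pos by (simp del: power_Suc)
  ultimately show ?case
    using prime_power_dvd_multD assms(1) prime_imp_prime_elem by (metis add_Suc_right zero_less_Suc)
qed

section \<open>Rounded logarithms and products of prime powers\<close>

lemma less_power_floor_log:
  fixes b n :: nat
  assumes "1 < b"
  shows "n < b ^ Suc (nat \<lfloor>log b n\<rfloor>)"
proof (rule ccontr)
  assume "\<not> ?thesis"
  hence "real b ^ Suc (nat \<lfloor>log b n\<rfloor>) \<le> n"
    by (metis not_less of_nat_le_iff of_nat_power)
  from le_log_of_power[OF this] show False using assms by linarith
qed

text \<open>With the previous bound: for \<open>n \<ge> 1\<close> the rounded logarithm is the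
  largest \<open>l\<close> with \<open>b ^ l \<le> n\<close>.\<close>

lemma power_floor_log_le:
  fixes b n :: nat
  assumes "1 < b" "1 \<le> n"
  shows "b ^ nat \<lfloor>log b n\<rfloor> \<le> n"
proof -
  have "0 \<le> log b n" using assms by simp
  hence "real (nat \<lfloor>log b n\<rfloor>) \<le> log b n" by linarith
  hence "real (b ^ nat \<lfloor>log b n\<rfloor>) \<le> real n"
    using assms le_log_iff[of b n "real (nat \<lfloor>log b n\<rfloor>)"]
      powr_realpow[of b "nat \<lfloor>log b n\<rfloor>"] by (simp del: of_nat_nat)
  thus ?thesis by linarith
qed

text \<open>Powers of distinct primes are coprime, so divisibility by the characteristic or by the
  half period can be checked one prime at a time.\<close>

lemma prod_prime_powers_dvd_iff:
  fixes p e :: "'i \<Rightarrow> nat"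
  assumes "finite I" "inj_on p I" "\<And>i. i \<in> I \<Longrightarrow> prime (p i)"
  shows "(\<Prod>i\<in>I. p i ^ e i) dvd x \<longleftrightarrow> (\<forall>i\<in>I. p i ^ e i dvd x)"
  using assms
proof (induction I rule: finite_induct)
  case (insert i I)
  have "coprime (p i ^ e i) (\<Prod>i\<in>I. p i ^ e i)"
    using insert.prems insert.hyps
    by (intro prod_coprime_right coprime_power_left_iff[THEN iffD2] disjI1
        coprime_power_right_iff[THEN iffD2] primes_coprime) auto
  hence "p i ^ e i * (\<Prod>i\<in>I. p i ^ e i) dvd x \<longleftrightarrow> p i ^ e i dvd x \<and> (\<Prod>i\<in>I. p i ^ e i) dvd x"
    by (auto intro: divides_mult dest: dvd_mult_left dvd_mult_right)
  then show ?case using insert by simp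
qed simp

section \<open>The operator 1 + S\<close>

definition add_shift :: "'a::comm_ring_1 poly \<Rightarrow> 'a poly" where
  "add_shift f = f + poly_shift 1 f"

lemma coeff_add_shift: "coeff (add_shift f) k = coeff f k + coeff f (Suc k)"
  by (simp add: add_shift_def coeff_poly_shift)

text \<open>The binomial theorem for (1 + S)^j, since S^i moves coefficient \<open>k + i\<close> to
  position \<open>k\<close>.\<close>

lemma coeff_funpow_add_shift:
  "coeff ((add_shift ^^ j) f) k = (\<Sum>i\<le>j. of_nat (j choose i) * coeff f (k + i))"
proof (induction j arbitrary: k)
  case (Suc j)
  have "coeff ((add_shift ^^ Suc j) f) k =
      (\<Sum>i\<le>j. of_nat (j choose i) * coeff f (k + i)) +
      (\<Sum>i\<le>j. of_nat (j choose i) * coeff f (k + Suc i))"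
    by (simp add: coeff_add_shift Suc.IH)
  \<comment> \<open>The added term is zero; it aligns the two sums for Pascal's rule.\<close>
  also have "(\<Sum>i\<le>j. of_nat (j choose i) * coeff f (k + i)) =
      (\<Sum>i\<le>Suc j. of_nat (j choose i) * coeff f (k + i))"
    by (simp add: binomial_eq_0)
  also have "\<dots> = coeff f k + (\<Sum>i\<le>j. of_nat (j choose Suc i) * coeff f (k + Suc i))"
    by (subst sum.atMost_Suc_shift) simp
  also have "\<dots> + (\<Sum>i\<le>j. of_nat (j choose i) * coeff f (k + Suc i)) =
      (\<Sum>i\<le>Suc j. of_nat (Suc j choose i) * coeff f (k + i))"
    by (subst sum.atMost_Suc_shift) (simp add: sum.distrib algebra_simps)
  finally show ?case .
qed simp

text \<open>Makes the summation range independent of \<open>j\<close>: binomials vanish beyond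
  \<open>j\<close>, coefficients beyond the degree, and the term for \<open>i = 0\<close> is
  \<open>coeff f k\<close>.\<close>

lemma coeff_funpow_add_shift_diff:
  "coeff ((add_shift ^^ j) f) k - coeff f k =
     (\<Sum>i\<in>{1..degree f - k}. of_nat (j choose i) * coeff f (k + i))"
proof -
  let ?t = "\<lambda>i. of_nat (j choose i) * coeff f (k + i)"
  have "sum ?t {..j} = sum ?t (insert 0 {1..degree f - k})"
    by (rule sum.mono_neutral_cong)
       (auto simp: binomial_eq_0 coeff_eq_0)
  thus ?thesis by (simp add: coeff_funpow_add_shift)
qed

lemma funpow_add_shift_eqI:
  fixes f :: "'a::comm_ring_1 poly"
  assumes "\<And>i. i \<in> {1..degree f} \<Longrightarrow> CHAR('a) dvd (j choose i)"
  shows "(add_shift ^^ j) f = f"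
proof (rule poly_eqI)
  fix k
  have "of_nat (j choose i) = (0::'a)" if "i \<in> {1..degree f - k}" for i
    using assms[of i] that by (subst of_nat_eq_0_iff_char_dvd) auto
  thus "coeff ((add_shift ^^ j) f) k = coeff f k"
    using coeff_funpow_add_shift_diff[of j f k] by simp
qed

text \<open>Compare coefficients at position \<open>degree f - i\<close>. The terms below
  \<open>i\<close> vanish by induction, which leaves \<open>j choose i\<close> times the leading
  coefficient, a unit.\<close>

lemma funpow_add_shift_eqD:
  fixes f :: "'a::comm_ring_1 poly"
  assumes eq: "(add_shift ^^ j) f = f" and u: "lead_coeff f dvd 1" and "i \<in> {1..degree f}"
  shows "CHAR('a) dvd (j choose i)"
  using assms(3)
proof (induction i rule: less_induct)
  case (less i)
  define k where "k = degree f - i"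
  have k: "degree f - k = i" "k + i = degree f" using less.prems by (auto simp: k_def)
  have "0 = (\<Sum>l\<in>{1..i}. of_nat (j choose l) * coeff f (k + l))"
    using coeff_funpow_add_shift_diff[of j f k] eq k by simp
  also have "\<dots> = (\<Sum>l\<in>{i}. of_nat (j choose l) * coeff f (k + l))"
  proof (rule sum.mono_neutral_right)
    show "\<forall>l\<in>{1..i} - {i}. of_nat (j choose l) * coeff f (k + l) = 0"
      using less by (auto simp: of_nat_eq_0_iff_char_dvd[THEN iffD2])
  qed (use less.prems in auto)
  finally have "of_nat (j choose i) * lead_coeff f = 0" using k by simp
  moreover from u obtain v where "lead_coeff f * v = 1" by (metis dvd_def)
  ultimately have "of_nat (j choose i) = (0::'a)"
    by (metis mult.assoc mult_1_right mult_zero_left)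
  thus ?case by (simp add: of_nat_eq_0_iff_char_dvd)
qed

lemma degree_add_shift:
  assumes "f \<noteq> 0"
  shows "add_shift f \<noteq> 0" "degree (add_shift f) = degree f"
proof -
  have "coeff (add_shift f) (degree f) \<noteq> 0" using assms by (simp add: coeff_add_shift coeff_eq_0)
  moreover have "degree (add_shift f) \<le> degree f"
    by (rule degree_le) (simp add: coeff_add_shift coeff_eq_0)
  ultimately show "add_shift f \<noteq> 0" "degree (add_shift f) = degree f"
    by (auto intro: le_antisym le_degree)
qed

section \<open>Cycles of the Collatz map\<close>

text \<open>A multiplication step is (1 + S) followed by multiplication by x, and the next step
  undoes the latter.\<close>

lemma collatz_nonzero_const:
  assumes "coeff f 0 \<noteq> 0"
  shows "collatz f = pCons 0 (add_shift f)"
proof (rule poly_eqI)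
  fix n
  show "coeff (collatz f) n = coeff (pCons 0 (add_shift f)) n"
    using assms by (cases n) (simp_all add: collatz_def coeff_add_shift algebra_simps)
qed

lemma collatz_pCons_0 [simp]: "collatz (pCons 0 g) = g"
  by (rule poly_eqI) (simp add: collatz_def coeff_poly_shift)

lemma zero_const_poly: "coeff f 0 = 0 \<Longrightarrow> f = pCons 0 (collatz f)"
  by (cases f) simp

text \<open>The correction by one absorbs the degree gained in a multiplication step, so that
  the weight never increases along an orbit.\<close>

definition weight :: "'a::comm_ring_1 poly \<Rightarrow> nat" where
  "weight f = degree f - (if coeff f 0 = 0 then 1 else 0)"

text \<open>A multiplication step keeps the weight: the degree grows by one and the constant
  coefficient becomes zero. A division step from x g to g keeps it if g has nonzero constant
  coefficient and lowers it otherwise.\<close>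

lemma collatz_weight:
  assumes "f \<noteq> 0"
  shows "collatz f \<noteq> 0" "weight (collatz f) \<le> weight f"
    "coeff f 0 = 0 \<Longrightarrow> coeff (collatz f) 0 = 0 \<Longrightarrow> weight (collatz f) < weight f"
proof -
  have *: "collatz f \<noteq> 0 \<and> weight (collatz f) \<le> weight f \<and>
    (coeff f 0 = 0 \<longrightarrow> coeff (collatz f) 0 = 0 \<longrightarrow> weight (collatz f) < weight f)"
  proof (cases "coeff f 0 = 0")
    case True
    then obtain g where g: "f = pCons 0 g" "g \<noteq> 0" using zero_const_poly assms by fastforce
    \<comment> \<open>Natural subtraction truncates, so the strict drop needs a positive
      degree.\<close>
    have "degree g > 0" if "coeff g 0 = 0"
      using that g(2) by (metis bot_nat_0.not_eq_extremum leading_coeff_0_iff)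
    thus ?thesis using g by (auto simp: weight_def)
  next
    case False
    thus ?thesis
      using degree_add_shift[OF assms] by (simp add: collatz_nonzero_const weight_def)
  qed
  show "collatz f \<noteq> 0" "weight (collatz f) \<le> weight f"
    "coeff f 0 = 0 \<Longrightarrow> coeff (collatz f) 0 = 0 \<Longrightarrow> weight (collatz f) < weight f"
    using * by auto
qed

lemma funpow_collatz_weight:
  assumes "f \<noteq> 0"
  shows "(collatz ^^ i) f \<noteq> 0 \<and> weight ((collatz ^^ i) f) \<le> weight f"
proof (induction i)
  case (Suc i)
  then show ?case
    using collatz_weight(1,2)[of "(collatz ^^ i) f"] by simp
qed (use assms in simp)

text \<open>The property shared by nonzero cycles and by the tails of all nonzero orbits, so that
  one argument serves both.\<close>

definition weight_stable :: "'a::comm_ring_1 poly \<Rightarrow> bool" where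
  "weight_stable f \<longleftrightarrow> f \<noteq> 0 \<and> (\<forall>i. weight ((collatz ^^ i) f) = weight f)"

lemma weight_stable_funpow:
  assumes "weight_stable f"
  shows "weight_stable ((collatz ^^ m) f)"
proof -
  have "(collatz ^^ i) ((collatz ^^ m) f) = (collatz ^^ (i + m)) f" for i
    by (simp add: funpow_add)
  thus ?thesis using assms funpow_collatz_weight[of f m] by (simp add: weight_stable_def)
qed

lemma weight_stable_collatz:
  assumes "weight_stable f"
  shows "weight_stable (collatz f)"
  using weight_stable_funpow[OF assms, of 1] by simp

text \<open>The weight never increases, and \<open>f\<close> is reached again from every point of
  its orbit, so it cannot decrease either.\<close>

lemma periodic_imp_weight_stable:
  assumes "collatz_periodic f" "f \<noteq> 0"
  shows "weight_stable f"
proof -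
  obtain k where k: "k \<ge> 1" "(collatz ^^ k) f = f" using assms(1) by (auto simp: collatz_periodic_def)
  have "weight f \<le> weight ((collatz ^^ i) f)" for i
  proof -
    have "(collatz ^^ (k * i)) f = f"
      by (induction i) (simp_all add: funpow_add k(2))
    moreover have "k * i = (k * i - i) + i" using k(1) by simp
    ultimately have "(collatz ^^ (k * i - i)) ((collatz ^^ i) f) = f"
      by (metis comp_apply funpow_add)
    thus ?thesis
      using funpow_collatz_weight[of "(collatz ^^ i) f" "k * i - i"]
        funpow_collatz_weight[OF assms(2), of i] by simp
  qed
  thus ?thesis
    using funpow_collatz_weight[OF assms(2)] assms(2)
    by (auto simp: weight_stable_def intro: le_antisym)
qed

text \<open>Start from a point of the orbit where the weight, a natural number, is minimal.\<close>

lemma eventually_weight_stable: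
  assumes "f \<noteq> 0"
  shows "\<exists>m. weight_stable ((collatz ^^ m) f)"
proof -
  obtain m where m: "\<And>i. weight ((collatz ^^ m) f) \<le> weight ((collatz ^^ i) f)"
    using ex_has_least_nat[of "\<lambda>_. True" 0 "\<lambda>m. weight ((collatz ^^ m) f)"] by auto
  have nz: "(collatz ^^ m) f \<noteq> 0" using funpow_collatz_weight[OF assms] by blast
  have "weight ((collatz ^^ i) ((collatz ^^ m) f)) = weight ((collatz ^^ m) f)" for i
    using m[of "i + m"] funpow_collatz_weight[OF nz, of i] by (simp add: funpow_add)
  thus ?thesis using nz by (auto simp: weight_stable_def)
qed

lemma weight_stable_nonzero_const:
  assumes "weight_stable f" "coeff f 0 = 0"
  shows "coeff (collatz f) 0 \<noteq> 0"
proof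
  assume "coeff (collatz f) 0 = 0"
  hence "weight (collatz f) < weight f"
    using assms by (intro collatz_weight(3)) (auto simp: weight_stable_def)
  moreover have "weight ((collatz ^^ 1) f) = weight f" using assms(1) unfolding weight_stable_def by blast
  ultimately show False by simp
qed

text \<open>Under constant weight, multiplications and divisions alternate, and each pair acts as 1
  + S.\<close>

lemma weight_stable_even_steps:
  assumes "weight_stable f" "coeff f 0 \<noteq> 0"
  shows "(collatz ^^ (2 * j)) f = (add_shift ^^ j) f \<and> coeff ((add_shift ^^ j) f) 0 \<noteq> 0"
proof (induction j)
  case (Suc j)
  define g where "g = (add_shift ^^ j) f"
  have g: "weight_stable g" "coeff g 0 \<noteq> 0"
    using Suc weight_stable_funpow[OF assms(1), of "2 * j"] by (auto simp: g_def)
  have "(collatz ^^ (2 * Suc j)) f = collatz (collatz ((collatz ^^ (2 * j)) f))" by simp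
  also have "\<dots> = collatz (collatz g)" using Suc by (simp add: g_def)
  also have "\<dots> = add_shift g" by (simp add: collatz_nonzero_const g(2))
  finally have "(collatz ^^ (2 * Suc j)) f = add_shift g" .
  \<comment> \<open>\<open>collatz g\<close> has zero constant coefficient, and a second zero in a
    row would lower the weight.\<close>
  moreover have "coeff (add_shift g) 0 \<noteq> 0"
    using weight_stable_nonzero_const[OF weight_stable_collatz[OF g(1)]] g(2)
    by (simp add: collatz_nonzero_const)
  ultimately show ?case by (simp add: g_def)
qed (use assms in simp)

text \<open>After an odd number of steps the constant coefficient is zero, unlike that of
  \<open>f\<close>.\<close>

lemma funpow_collatz_fixed_even:
  assumes "weight_stable f" "coeff f 0 \<noteq> 0" "(collatz ^^ k) f = f"
  shows "even k"
proof (rule ccontr)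
  assume "odd k"
  then obtain j where k: "k = Suc (2 * j)" by (auto elim: oddE)
  have "(collatz ^^ k) f = pCons 0 (add_shift ((add_shift ^^ j) f))"
    using weight_stable_even_steps[OF assms(1,2), of j] by (simp add: k collatz_nonzero_const)
  thus False using assms(2,3) by (metis coeff_pCons_0)
qed

section \<open>Periods and eventual periodicity\<close>

lemma collatz_period_fixed:
  assumes "collatz_periodic f"
  shows "collatz_period f \<ge> 1" "(collatz ^^ collatz_period f) f = f"
  using LeastI_ex[OF assms[unfolded collatz_periodic_def]] by (auto simp: collatz_period_def)

lemma collatz_period_dvd:
  assumes "collatz_periodic f" "(collatz ^^ k) f = f"
  shows "collatz_period f dvd k"
proof -
  let ?r = "k mod collatz_period f"
  have "(collatz ^^ ?r) f = f"
    using funpow_mod_eq[OF collatz_period_fixed(2)[OF assms(1)], of k] assms(2) by simp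
  moreover have "?r < collatz_period f" using collatz_period_fixed(1)[OF assms(1)] by simp
  ultimately have "\<not> ?r \<ge> 1" unfolding collatz_period_def using not_less_Least by blast
  thus ?thesis by (simp add: dvd_eq_mod_eq_0)
qed

lemma collatz_period_even:
  assumes "collatz_periodic f" "coeff f 0 \<noteq> 0"
  obtains j where "collatz_period f = 2 * j" "0 < j" "(add_shift ^^ j) f = f"
proof -
  have s: "weight_stable f" using assms by (intro periodic_imp_weight_stable) auto
  have "even (collatz_period f)"
    using funpow_collatz_fixed_even[OF s assms(2)] collatz_period_fixed[OF assms(1)] by blast
  then obtain j where j: "collatz_period f = 2 * j" by (elim evenE)
  show thesis
    using that[OF j] collatz_period_fixed[OF assms(1)] j weight_stable_even_steps[OF s assms(2), of j]
    by simp
qed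

text \<open>Once the weight is stable, at most one more step reaches a nonzero constant coefficient.
  There (1 + S)^j is the identity for the \<open>j\<close> supplied for the degree reached.\<close>

lemma collatz_eventually_periodicI:
  fixes f :: "'a::comm_ring_1 poly"
  assumes ex: "\<And>n. \<exists>j>0. \<forall>i\<in>{1..n}. CHAR('a) dvd (j choose i)"
  shows "collatz_eventually_periodic f"
proof (cases "f = 0")
  case True
  have "collatz_periodic f" unfolding collatz_periodic_def
    using True by (intro exI[of _ 1]) (simp add: collatz_def)
  thus ?thesis unfolding collatz_eventually_periodic_def by (metis funpow_0)
next
  case False
  obtain m where m: "weight_stable ((collatz ^^ m) f)"
    using eventually_weight_stable[OF False] by blast
  obtain m' where m': "weight_stable ((collatz ^^ m') f)" "coeff ((collatz ^^ m') f) 0 \<noteq> 0"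
  proof (cases "coeff ((collatz ^^ m) f) 0 = 0")
    case True
    show thesis
      using that[of "Suc m"] weight_stable_collatz[OF m] weight_stable_nonzero_const[OF m True] by simp
  next
    case False
    show thesis using that[OF m False] .
  qed
  define g where "g = (collatz ^^ m') f"
  obtain j where j: "j > 0" "\<And>i. i \<in> {1..degree g} \<Longrightarrow> CHAR('a) dvd (j choose i)"
    using ex[of "degree g"] by blast
  have "(collatz ^^ (2 * j)) g = g"
    using weight_stable_even_steps[OF m'[folded g_def], of j] funpow_add_shift_eqI[OF j(2)] by simp
  hence "collatz_periodic g" using j(1) unfolding collatz_periodic_def by (intro exI[of _ "2 * j"]) simp
  thus ?thesis unfolding collatz_eventually_periodic_def g_def by blast
qed

section \<open>Short cycles and the torsion-free classification\<close>

lemma collatz_periodic_collatz: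
  assumes "collatz_periodic f"
  shows "collatz_periodic (collatz f)"
  using assms unfolding collatz_periodic_def by (metis funpow_swap1)

lemma collatz_orbit_zero: "collatz_periodic (0 :: 'a::comm_ring_1 poly)" "collatz_orbit (0 :: 'a poly) = [0]"
proof -
  have z: "collatz (0 :: 'a poly) = 0" by (simp add: collatz_def)
  show p: "collatz_periodic (0 :: 'a poly)" unfolding collatz_periodic_def using z by (intro exI[of _ 1]) simp
  have "collatz_period (0 :: 'a poly) = 1"
    using collatz_period_dvd[OF p, of 1] z by simp
  thus "collatz_orbit (0 :: 'a poly) = [0]" by (simp add: collatz_orbit_def)
qed

lemma collatz_orbit_two_cycle:
  assumes "collatz f = g" "collatz g = f" "f \<noteq> g"
  shows "collatz_periodic f" "collatz_orbit f = [f, g]"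
proof -
  have two: "(collatz ^^ 2) f = f" using assms by (simp add: numeral_2_eq_2)
  thus p: "collatz_periodic f" unfolding collatz_periodic_def by (intro exI[of _ 2]) simp
  have "collatz_period f \<noteq> 1" using collatz_period_fixed(2)[OF p] assms by auto
  moreover have "collatz_period f dvd 2" using collatz_period_dvd[OF p two] .
  ultimately have "collatz_period f = 2"
    by (metis prime_nat_iff two_is_prime_nat)
  thus "collatz_orbit f = [f, g]" using assms by (simp add: collatz_orbit_def upt_rec)
qed

lemma collatz_const: "a \<noteq> 0 \<Longrightarrow> collatz [:a:] = [:0, a:]"
  by (simp add: collatz_def)

text \<open>For positive degree, (1 + S)^j adds \<open>j\<close> times the leading coefficient to
  the coefficient just below it; torsion-freeness forbids this to be zero.\<close>

lemma torsion_free_periodic_const: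
  fixes f :: "'a::comm_ring_1 poly"
  assumes tf: "additively_torsion_free TYPE('a)" and f: "collatz_periodic f" "coeff f 0 \<noteq> 0"
  shows "degree f = 0"
proof (rule ccontr)
  assume "degree f \<noteq> 0"
  obtain j where j: "0 < j" "(add_shift ^^ j) f = f" using collatz_period_even[OF f] by metis
  have "degree f - (degree f - 1) = 1" using \<open>degree f \<noteq> 0\<close> by simp
  hence "of_nat j * lead_coeff f = 0"
    using coeff_funpow_add_shift_diff[of j f "degree f - 1"] j(2) \<open>degree f \<noteq> 0\<close> by simp
  hence "lead_coeff f = 0" using tf j(1) unfolding additively_torsion_free_def by blast
  thus False using \<open>degree f \<noteq> 0\<close> by auto
qed

text \<open>The rotation records the starting point: 0 for a constant, 1 for a polynomial whose
  image is a constant.\<close>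

lemma torsion_free_cycles:
  fixes c :: "'a::comm_ring_1 poly list"
  assumes tf: "additively_torsion_free TYPE('a)" and "collatz_cycle c"
  shows "c = [0] \<or> (\<exists>a k. a \<noteq> 0 \<and> c = rotate k [[:a:], [:0, a:]])"
proof -
  obtain f where f: "collatz_periodic f" "c = collatz_orbit f"
    using assms(2) by (auto simp: collatz_cycle_def)
  consider "f = 0" | "coeff f 0 \<noteq> 0" | "f \<noteq> 0" "coeff f 0 = 0" by blast
  thus ?thesis
  proof cases
    case 1
    thus ?thesis using f(2) collatz_orbit_zero(2)[where 'a = 'a] by simp
  next
    case 2
    then obtain a where a: "f = [:a:]" "a \<noteq> 0"
      using torsion_free_periodic_const[OF tf f(1)] by (auto elim: degree_eq_zeroE)
    hence "c = rotate 0 [[:a:], [:0, a:]]"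
      using collatz_orbit_two_cycle(2)[of f "[:0, a:]"] f(2) by (simp add: collatz_const)
    thus ?thesis using a(2) by blast
  next
    case 3
    have "coeff (collatz f) 0 \<noteq> 0"
      using weight_stable_nonzero_const[OF periodic_imp_weight_stable] f(1) 3 by blast
    then obtain a where a: "collatz f = [:a:]" "a \<noteq> 0"
      using torsion_free_periodic_const[OF tf collatz_periodic_collatz[OF f(1)]]
      by (auto elim: degree_eq_zeroE)
    hence "f = [:0, a:]" using zero_const_poly[OF 3(2)] by simp
    hence "c = rotate 1 [[:a:], [:0, a:]]"
      using collatz_orbit_two_cycle(2)[of f "[:a:]"] f(2) a(2) by (simp add: collatz_const)
    thus ?thesis using a(2) by blast
  qed
qed

text \<open>Equality is claimed from degree 1 on: a nonzero constant has period 2, while the product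
  formula would give at least \<open>2 * CHAR('a)\<close>. The classification assumes
  torsion-freeness because torsion elements create further cycles.\<close>

theorem theorem1p1:
  shows "(CHAR('a::comm_ring_1) = 0 \<longrightarrow>
            collatz_cycle [0 :: 'a poly] \<and>
            (\<forall>a::'a. a \<noteq> 0 \<longrightarrow> collatz_cycle [[:a:], [:0, a:]]) \<and>
            (additively_torsion_free TYPE('a) \<longrightarrow>
              (\<forall>c :: 'a poly list. collatz_cycle c \<longrightarrow>
                 c = [0] \<or> (\<exists>a k. a \<noteq> 0 \<and> c = rotate k [[:a:], [:0, a:]])))) \<and>
         (\<forall>(s::nat) (p :: nat \<Rightarrow> nat) (\<alpha> :: nat \<Rightarrow> nat).
            s \<ge> 1 \<and> inj_on p {1..s} \<and> (\<forall>i\<in>{1..s}. prime (p i) \<and> \<alpha> i \<ge> 1) \<and>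
            CHAR('a) = (\<Prod>i=1..s. p i ^ \<alpha> i) \<longrightarrow>
              (\<forall>f :: 'a poly. collatz_eventually_periodic f) \<and>
              (\<forall>f :: 'a poly. collatz_periodic f \<and> coeff f 0 \<noteq> 0 \<longrightarrow>
                 collatz_period f dvd
                   2 * (\<Prod>i=1..s. p i ^ (\<alpha> i + nat \<lfloor>log (real (p i)) (real (degree f))\<rfloor>)) \<and>
                 (degree f \<ge> 1 \<and> lead_coeff f dvd 1 \<longrightarrow>
                    collatz_period f =
                      2 * (\<Prod>i=1..s. p i ^ (\<alpha> i + nat \<lfloor>log (real (p i)) (real (degree f))\<rfloor>)))))"
proof (intro conjI impI allI)
  show "collatz_cycle [0 :: 'a poly]"
    unfolding collatz_cycle_def using collatz_orbit_zero by metis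
next
  fix a :: 'a assume "a \<noteq> 0"
  thus "collatz_cycle [[:a:], [:0, a:]]"
    unfolding collatz_cycle_def
    using collatz_orbit_two_cycle[of "[:a:]" "[:0, a:]"] by (auto simp: collatz_const)
next
  fix c :: "'a poly list"
  assume "additively_torsion_free TYPE('a)" "collatz_cycle c"
  thus "c = [0] \<or> (\<exists>a k. a \<noteq> 0 \<and> c = rotate k [[:a:], [:0, a:]])"
    by (rule torsion_free_cycles)
next
  fix s :: nat and p \<alpha> :: "nat \<Rightarrow> nat"
  assume *: "s \<ge> 1 \<and> inj_on p {1..s} \<and> (\<forall>i\<in>{1..s}. prime (p i) \<and> \<alpha> i \<ge> 1) \<and>
    CHAR('a) = (\<Prod>i=1..s. p i ^ \<alpha> i)"
  \<comment> \<open>Half of the claimed period in degree \<open>n\<close>.\<close>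
  define M where "M n = (\<Prod>i=1..s. p i ^ (\<alpha> i + nat \<lfloor>log (real (p i)) (real n)\<rfloor>))" for n :: nat
  have prime: "prime (p i)" "1 < p i" "1 \<le> \<alpha> i" if "i \<in> {1..s}" for i
    using * that by (auto intro: prime_gt_1_nat simp del: One_nat_def)
  have prod_dvd: "(\<Prod>i=1..s. p i ^ e i) dvd x \<longleftrightarrow> (\<forall>i\<in>{1..s}. p i ^ e i dvd x)" for e x
    using * by (intro prod_prime_powers_dvd_iff) auto
  have char_dvd: "CHAR('a) dvd x \<longleftrightarrow> (\<forall>i\<in>{1..s}. p i ^ \<alpha> i dvd x)" for x
    using * prod_dvd by simp
  have M_pos: "M n > 0" for n
    unfolding M_def using prime(1) by (intro prod_pos) (auto simp: prime_gt_0_nat)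
  \<comment> \<open>Upper bound: \<open>n\<close> lies below the next power of each prime, so every
    index up to \<open>n\<close> is admissible.\<close>
  have M_choose: "CHAR('a) dvd (M n choose k)" if k: "k \<in> {1..n}" for n k
  proof (unfold char_dvd, intro ballI)
    fix i assume i: "i \<in> {1..s}"
    show "p i ^ \<alpha> i dvd (M n choose k)"
    proof (rule prime_power_dvd_choose)
      show "p i ^ (\<alpha> i + nat \<lfloor>log (real (p i)) (real n)\<rfloor>) dvd M n"
        using prod_dvd[of _ "M n"] i unfolding M_def by blast
      show "k < p i ^ Suc (nat \<lfloor>log (real (p i)) (real n)\<rfloor>)"
        using k less_power_floor_log[OF prime(2)[OF i], of n] by simp
    qed (use prime[OF i] k in auto)
  qed
  show "collatz_eventually_periodic f" for f :: "'a poly"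
    using M_choose M_pos by (intro collatz_eventually_periodicI) blast
  fix f :: "'a poly"
  assume f: "collatz_periodic f \<and> coeff f 0 \<noteq> 0"
  hence stable: "weight_stable f" by (intro periodic_imp_weight_stable) auto
  have "(collatz ^^ (2 * M (degree f))) f = f"
    using weight_stable_even_steps[OF stable, of "M (degree f)"] f
      funpow_add_shift_eqI[OF M_choose, of f] by simp
  hence dvd: "collatz_period f dvd 2 * M (degree f)" using collatz_period_dvd f by blast
  thus "collatz_period f dvd
      2 * (\<Prod>i=1..s. p i ^ (\<alpha> i + nat \<lfloor>log (real (p i)) (real (degree f))\<rfloor>))"
    by (simp add: M_def)
  assume u: "degree f \<ge> 1 \<and> lead_coeff f dvd 1"
  obtain j where j: "collatz_period f = 2 * j" "0 < j" "(add_shift ^^ j) f = f"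
    using collatz_period_even f by metis
  have choose: "CHAR('a) dvd (j choose k)" if "k \<in> {1..degree f}" for k
    using funpow_add_shift_eqD[OF j(3)] u that by blast
  \<comment> \<open>Lower bound: the powers of each prime up to the degree are indices at which the
    binomial is known to vanish in the ring.\<close>
  have "M (degree f) dvd j"
  proof (unfold M_def prod_dvd, intro ballI)
    fix i assume i: "i \<in> {1..s}"
    show "p i ^ (\<alpha> i + nat \<lfloor>log (real (p i)) (real (degree f))\<rfloor>) dvd j"
    proof (rule prime_power_dvd_of_dvd_choose[OF prime(1,3)[OF i] j(2)])
      fix m assume "m \<le> nat \<lfloor>log (real (p i)) (real (degree f))\<rfloor>"
      hence "p i ^ m \<le> p i ^ nat \<lfloor>log (real (p i)) (real (degree f))\<rfloor>"
        using prime(2)[OF i] by (intro power_increasing) auto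
      also have "\<dots> \<le> degree f" using power_floor_log_le[OF prime(2)[OF i]] u by blast
      finally have "p i ^ m \<in> {1..degree f}" using prime(2)[OF i] by simp
      thus "p i ^ \<alpha> i dvd (j choose (p i ^ m))" using choose i unfolding char_dvd by blast
    qed
  qed
  hence "2 * M (degree f) dvd collatz_period f" using j(1) by simp
  hence "collatz_period f = 2 * M (degree f)" using dvd by (intro dvd_antisym)
  thus "collatz_period f =
      2 * (\<Prod>i=1..s. p i ^ (\<alpha> i + nat \<lfloor>log (real (p i)) (real (degree f))\<rfloor>))"
    by (simp add: M_def)
qed

end
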